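(* Let $\mathcal T$ be a regular rooted tree and let $G$ be a weakly branched subgroup of $\mathrm{Aut}(\mathcal T)$. For every integer $n>0$, the $*$-homomorphism $\rho_{\mathcal T}^{\otimes n}$ defined on $\mathbb C G$ is not faithful (i.e. not injective). In particular, the representation $\rho_{\mathcal T}^{\otimes n}$ of $G$ does not weakly contain the regular representation $\lambda$ of $G$.
   Context: Regular rooted tree: for an integer $d>1$, $\mathcal T$ is the infinite tree with a distinguished vertex $\varnothing$ (the root) of degree $d$ in which every other vertex has degree $d+1$. $\mathcal T^0$ is its set of vertices, the $n$-th level $L_n$ is the set of vertices at distance $n$ from the root, and $\mathrm{Aut}(\mathcal T)$ is the group of graph automorphisms of $\mathcal T$ fixing the root. For $v\in\mathcal T^0$, the subtree $v\mathcal T$ is the connected subgraph whose vertices are the descendants of $v$, i.e. the vertices $w$ such that $v$ lies on the geodesic path from $\varnothing$ to $w$. For $G\le\mathrm{Aut}(\mathcal T)$, $\mathrm{Stab}_G(v\mathcal T):=\{g\in G\mid g(x)=x\ \text{for all vertices } x\in v\mathcal T\}$. A finitely generated subgroup $G$ of $\mathrm{Aut}(\mathcal T)$ is weakly branched if it acts transitively on every level $L_n$ and, for every $v\in\mathcal T^0$, the rigid stabilizer $$\mathrm{Rist}_G(v):=\bigcap_{w\in L_n\setminus\{v\}}\mathrm{Stab}_G(w\mathcal T),\qquad n \text{ being the level of } v,$$ is non-trivial. $\rho_{\mathcal T}$ is the unitary representation of $G$ on $\ell^2(\mathcal T^0)$ given by $\rho_{\mathcal T}(g)(\xi)(v)=\xi(g^{-1}\cdot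 v)$; $\rho_{\mathcal T}^{\otimes n}$ is its $n$-fold tensor power, i.e. the permutation representation of $G$ on $\ell^2((\mathcal T^0)^n)$ for the diagonal action, extended linearly to a $*$-homomorphism on the group algebra $\mathbb C G$. The regular representation $\lambda$ of $G$ on $\ell^2(G)$ is $\lambda(g)(\xi)(h)=\xi(g^{-1}h)$. Weak containment: $\pi_2$ weakly contains $\pi_1$, for unitary representations $(\pi_1,\mathcal H_1)$, $(\pi_2,\mathcal H_2)$ of $G$, if for all $\epsilon>0$, $\xi\in\mathcal H_1$ and finite $K\subset G$ there are vectors $\nu_1,\dots,\nu_m\in\mathcal H_2$ such that for all $g\in K$, $\left|\langle \pi_1(g)\xi\,|\,\xi\rangle-\sum_{i=1}^m\langle\pi_2(g)\nu_i\,|\,\nu_i\rangle\right|<\epsilon$. *)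

theory Defs
  imports
    "HOL-Analysis.Infinite_Sum"
    "HOL-Algebra.Bij"
    "HOL-Algebra.Generated_Groups"
    "HOL-Library.Poly_Mapping"
    "HOL-Library.NList"
begin

section \<open>Trees\<close>

text \<open>A simple graph is given by its vertex set \<open>V\<close> and its adjacency relation \<open>E\<close>.\<close>

definition simple_graph :: "'v set \<Rightarrow> ('v \<Rightarrow> 'v \<Rightarrow> bool) \<Rightarrow> bool" where
  "simple_graph V E \<longleftrightarrow>
     (\<forall>u v. E u v \<longrightarrow> u \<in> V \<and> v \<in> V \<and> u \<noteq> v \<and> E v u)"

text \<open>A walk is the list of its vertices, so its length as a walk is one less than the length of
  the list.\<close>

definition walk :: "'v set \<Rightarrow> ('v \<Rightarrow> 'v \<Rightarrow> bool) \<Rightarrow> 'v \<Rightarrow> 'v list \<Rightarrow> 'v \<Rightarrow> bool" where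
  "walk V E u p v \<longleftrightarrow>
     p \<noteq> [] \<and> set p \<subseteq> V \<and> successively E p \<and> hd p = u \<and> last p = v"

definition connected_graph :: "'v set \<Rightarrow> ('v \<Rightarrow> 'v \<Rightarrow> bool) \<Rightarrow> bool" where
  "connected_graph V E \<longleftrightarrow> V \<noteq> {} \<and> (\<forall>u\<in>V. \<forall>v\<in>V. \<exists>p. walk V E u p v)"

definition graph_cycle :: "('v \<Rightarrow> 'v \<Rightarrow> bool) \<Rightarrow> 'v list \<Rightarrow> bool" where
  "graph_cycle E c \<longleftrightarrow>
     3 \<le> length c \<and> distinct c \<and> successively E c \<and> E (last c) (hd c)"

definition graph_tree :: "'v set \<Rightarrow> ('v \<Rightarrow> 'v \<Rightarrow> bool) \<Rightarrow> bool" where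
  "graph_tree V E \<longleftrightarrow>
     simple_graph V E \<and> connected_graph V E \<and> (\<nexists>c. graph_cycle E c)"

definition graph_degree :: "('v \<Rightarrow> 'v \<Rightarrow> bool) \<Rightarrow> 'v \<Rightarrow> nat" where
  "graph_degree E v = card {w. E v w}"

text \<open>All degrees below are positive, so \<open>card\<close> being \<open>0\<close> on infinite sets is harmless; and since no
  vertex has degree at most \<open>1\<close>, such a tree is automatically infinite.\<close>

locale regular_rooted_tree =
  fixes d :: nat and V :: "'v set" and E :: "'v \<Rightarrow> 'v \<Rightarrow> bool" and r :: 'v
  assumes d_gt_1: "d > 1"
    and tree: "graph_tree V E"
    and r_in_V: "r \<in> V"
    and degree_root: "graph_degree E r = d"
    and degree_non_root: "\<And>v. v \<in> V \<Longrightarrow> v \<noteq> r \<Longrightarrow> graph_degree E v = d + 1"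

definition graph_dist :: "'v set \<Rightarrow> ('v \<Rightarrow> 'v \<Rightarrow> bool) \<Rightarrow> 'v \<Rightarrow> 'v \<Rightarrow> nat" where
  "graph_dist V E u v = (LEAST k. \<exists>p. walk V E u p v \<and> length p = k + 1)"

definition geodesic :: "'v set \<Rightarrow> ('v \<Rightarrow> 'v \<Rightarrow> bool) \<Rightarrow> 'v \<Rightarrow> 'v list \<Rightarrow> 'v \<Rightarrow> bool" where
  "geodesic V E u p v \<longleftrightarrow> walk V E u p v \<and> length p = graph_dist V E u v + 1"

definition tree_level :: "'v set \<Rightarrow> ('v \<Rightarrow> 'v \<Rightarrow> bool) \<Rightarrow> 'v \<Rightarrow> nat \<Rightarrow> 'v set" where
  "tree_level V E r n = {v \<in> V. graph_dist V E r v = n}"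

text \<open>The vertex set of the subtree at \<open>v\<close>; in a tree the geodesic \<open>p\<close> is unique.\<close>

definition subtree :: "'v set \<Rightarrow> ('v \<Rightarrow> 'v \<Rightarrow> bool) \<Rightarrow> 'v \<Rightarrow> 'v \<Rightarrow> 'v set" where
  "subtree V E r v = {w \<in> V. \<exists>p. geodesic V E r p w \<and> v \<in> set p}"


section \<open>Weakly branched groups\<close>

text \<open>As everywhere in \<open>BijGroup\<close>, automorphisms are \<open>undefined\<close> outside the vertex set, so that they
  are equal if and only if they agree on all vertices.\<close>

definition tree_Aut ::
    "'v set \<Rightarrow> ('v \<Rightarrow> 'v \<Rightarrow> bool) \<Rightarrow> 'v \<Rightarrow> ('v \<Rightarrow> 'v) monoid" where
  "tree_Aut V E r = (BijGroup V)
     \<lparr>carrier := {g \<in> Bij V. (\<forall>u\<in>V. \<forall>v\<in>V. E (g u) (g v) \<longleftrightarrow> E u v) \<and> g r = r}\<rparr>"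

definition subtree_Stab ::
    "'v set \<Rightarrow> ('v \<Rightarrow> 'v \<Rightarrow> bool) \<Rightarrow> 'v \<Rightarrow> ('v \<Rightarrow> 'v) set \<Rightarrow> 'v \<Rightarrow> ('v \<Rightarrow> 'v) set" where
  "subtree_Stab V E r G v = {g \<in> G. \<forall>x\<in>subtree V E r v. g x = x}"

text \<open>The intersection with \<open>G\<close> only matters when \<open>v\<close> is the root: then the index set is empty, and
  the empty intersection has to be taken inside \<open>G\<close>.\<close>

definition rist ::
    "'v set \<Rightarrow> ('v \<Rightarrow> 'v \<Rightarrow> bool) \<Rightarrow> 'v \<Rightarrow> ('v \<Rightarrow> 'v) set \<Rightarrow> 'v \<Rightarrow> ('v \<Rightarrow> 'v) set" where
  "rist V E r G v =
     G \<inter> (\<Inter>w \<in> tree_level V E r (graph_dist V E r v) - {v}. subtree_Stab V E r G w)"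

definition weakly_branched ::
    "'v set \<Rightarrow> ('v \<Rightarrow> 'v \<Rightarrow> bool) \<Rightarrow> 'v \<Rightarrow> ('v \<Rightarrow> 'v) set \<Rightarrow> bool" where
  "weakly_branched V E r G \<longleftrightarrow>
     subgroup G (tree_Aut V E r) \<and>
     (\<exists>S. finite S \<and> S \<subseteq> G \<and> generate (tree_Aut V E r) S = G) \<and>
     (\<forall>n. \<forall>u\<in>tree_level V E r n. \<forall>v\<in>tree_level V E r n. \<exists>g\<in>G. g u = v) \<and>
     (\<forall>v\<in>V. rist V E r G v \<noteq> {\<one>\<^bsub>tree_Aut V E r\<^esub>})"


section \<open>Representations on Hilbert spaces and weak containment\<close>

text \<open>The Hilbert space of square-summable functions on the set \<open>X\<close>; its elements are normalised to
  vanish outside \<open>X\<close>.\<close>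

definition ell2 :: "'x set \<Rightarrow> ('x \<Rightarrow> complex) set" where
  "ell2 X = {\<xi>. (\<forall>x. x \<notin> X \<longrightarrow> \<xi> x = 0) \<and> (\<lambda>x. (cmod (\<xi> x))\<^sup>2) summable_on X}"

definition ell2_inner :: "'x set \<Rightarrow> ('x \<Rightarrow> complex) \<Rightarrow> ('x \<Rightarrow> complex) \<Rightarrow> complex" where
  "ell2_inner X \<xi> \<eta> = (\<Sum>\<^sub>\<infinity>x\<in>X. \<xi> x * cnj (\<eta> x))"

text \<open>The data of a unitary representation that enter weak containment: the set of vectors of the
  Hilbert space, its inner product, and the operators.\<close>

record ('g, 'h) hilbert_rep =
  hspace :: "'h set"
  hinner :: "'h \<Rightarrow> 'h \<Rightarrow> complex"
  hop :: "'g \<Rightarrow> 'h \<Rightarrow> 'h"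

text \<open>\<open>weakly_contains G \<pi>\<^sub>2 \<pi>\<^sub>1\<close>: \<open>\<pi>\<^sub>2\<close> weakly contains \<open>\<pi>\<^sub>1\<close>.\<close>

definition weakly_contains ::
    "('g, 'm) monoid_scheme \<Rightarrow> ('g, 'h2) hilbert_rep \<Rightarrow> ('g, 'h1) hilbert_rep \<Rightarrow> bool" where
  "weakly_contains G \<pi>\<^sub>2 \<pi>\<^sub>1 \<longleftrightarrow>
     (\<forall>\<epsilon>>0. \<forall>\<xi>\<in>hspace \<pi>\<^sub>1. \<forall>K. finite K \<and> K \<subseteq> carrier G \<longrightarrow>
        (\<exists>\<nu>s. set \<nu>s \<subseteq> hspace \<pi>\<^sub>2 \<and>
           (\<forall>g\<in>K. cmod (hinner \<pi>\<^sub>1 (hop \<pi>\<^sub>1 g \<xi>) \<xi>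
                        - (\<Sum>\<nu>\<leftarrow>\<nu>s. hinner \<pi>\<^sub>2 (hop \<pi>\<^sub>2 g \<nu>) \<nu>)) < \<epsilon>)))"

text \<open>The permutation representation on \<open>ell2 X\<close> of an action \<open>act\<close> of \<open>G\<close> on \<open>X\<close>.\<close>

definition permutation_rep ::
    "('g, 'm) monoid_scheme \<Rightarrow> 'x set \<Rightarrow> ('g \<Rightarrow> 'x \<Rightarrow> 'x) \<Rightarrow> ('g, 'x \<Rightarrow> complex) hilbert_rep" where
  "permutation_rep G X act =
     \<lparr>hspace = ell2 X,
      hinner = ell2_inner X,
      hop = (\<lambda>g \<xi> x. if x \<in> X then \<xi> (act (inv\<^bsub>G\<^esub> g) x) else 0)\<rparr>"

definition regular_rep :: "('g, 'm) monoid_scheme \<Rightarrow> ('g, 'g \<Rightarrow> complex) hilbert_rep" where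
  "regular_rep G = permutation_rep G (carrier G) (\<lambda>g h. g \<otimes>\<^bsub>G\<^esub> h)"

text \<open>The \<open>n\<close>-fold tensor power of the representation on \<open>ell2 V\<close>, realised on the space of
  square-summable functions on \<open>n\<close>-tuples of vertices (lists of length \<open>n\<close>) with the diagonal
  action.\<close>

definition tree_rep_tensor ::
    "('v \<Rightarrow> 'v, 'm) monoid_scheme \<Rightarrow> 'v set \<Rightarrow> nat
      \<Rightarrow> ('v \<Rightarrow> 'v, 'v list \<Rightarrow> complex) hilbert_rep" where
  "tree_rep_tensor G V n = permutation_rep G (nlists n V) (\<lambda>g xs. map g xs)"


section \<open>Group algebras\<close>

definition group_algebra :: "('g, 'm) monoid_scheme \<Rightarrow> ('g \<Rightarrow>\<^sub>0 complex) set" where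
  "group_algebra G = {a. Poly_Mapping.keys a \<subseteq> carrier G}"

text \<open>The linear extension of a representation to the group algebra. An operator is represented by
  its restriction to the Hilbert space, so that equality of values is equality of operators.\<close>

definition algebra_rep ::
    "('g, 'x \<Rightarrow> complex) hilbert_rep \<Rightarrow> ('g \<Rightarrow>\<^sub>0 complex)
      \<Rightarrow> ('x \<Rightarrow> complex) \<Rightarrow> ('x \<Rightarrow> complex)" where
  "algebra_rep \<pi> a =
     (\<lambda>\<xi>\<in>hspace \<pi>. \<lambda>x. \<Sum>g\<in>Poly_Mapping.keys a. Poly_Mapping.lookup a g * hop \<pi> g \<xi> x)"

end

theory Submission
  imports Defs
begin

text \<open>
  The kernel of the representation contains an explicit product of \<open>n + 1\<close> factors \<open>1 - \<gamma>\<inverse>\<close>.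
  The levels of the tree are arbitrarily large, so some level contains \<open>n + 1\<close> vertices; pick in
  each of their rigid stabilizers an element \<open>\<gamma>\<^sub>v \<noteq> 1\<close>. Such an element fixes every vertex outside
  the subtree at \<open>v\<close> (\<open>rist_fixes_outside_subtree\<close>), and these subtrees are pairwise disjoint.
  Hence the \<open>\<gamma>\<^sub>v\<close> commute, and an \<open>n\<close>-tuple of vertices misses at least one of the \<open>n + 1\<close>
  subtrees, so that it is fixed by one of the \<open>\<gamma>\<^sub>v\<close>. The product \<open>a\<close> of all \<open>1 - \<gamma>\<^sub>v\<inverse>\<close> therefore
  annihilates every \<open>n\<close>-tuple. Expanding it gives \<open>a = (\<Sum>S. (-1) ^ card S \<cdot> \<gamma>\<^sub>S\<inverse>)\<close>, where
  \<open>\<gamma>\<^sub>S\<close> is the product of the \<open>\<gamma>\<^sub>v\<close> with \<open>v \<in> S\<close>. As \<open>\<gamma>\<^sub>S\<close> moves some point of the subtree at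
  \<open>v\<close> exactly if \<open>v \<in> S\<close>, it is trivial only for empty \<open>S\<close>; so the coefficient of \<open>a\<close> at the
  neutral element is \<open>1\<close>, and in particular \<open>a \<noteq> 0\<close>. This is \<open>exists_annihilator\<close>.

  The same element separates the regular representation from the tensor power
  (\<open>kernel_element_obstructs_weak_containment\<close>). The linear functional
  \<open>\<phi> \<mapsto> (\<Sum>g. a g * \<phi> g)\<close> on functions on the group vanishes at all diagonal matrix
  coefficients of the tensor power, because the tensor power kills \<open>a\<close>. At the function
  \<open>g \<mapsto> \<langle>\<lambda>(g)\<delta>\<^sub>1 | \<delta>\<^sub>1\<rangle>\<close>, which is the indicator of the neutral element, its value is the
  coefficient of \<open>a\<close> there, namely \<open>1\<close>. Since the functional only involves the finitely many
  group elements in the support of \<open>a\<close>, that function is not a limit of sums of diagonal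
  coefficients.
\<close>

section \<open>Walks and cycles\<close>

lemma walk_append:
  assumes "walk W E u p v" and "walk W E v q w"
  shows "walk W E u (p @ tl q) w"
  using assms
  by (cases q) (auto simp: walk_def successively_append_iff successively_Cons)

lemma walk_rev:
  assumes "simple_graph V E" and "walk W E u p v"
  shows "walk W E v (rev p) u"
proof -
  have "successively (\<lambda>x y. E y x) p"
    using assms by (auto simp: walk_def simple_graph_def intro: successively_mono)
  then show ?thesis
    using assms(2) by (simp add: walk_def hd_rev last_rev)
qed

lemma walk_take:
  assumes "walk W E u p v" and "i < length p"
  shows "walk W E u (take (Suc i) p) (p ! i)"
  using assms
  by (auto simp: walk_def successively_conv_nth last_conv_nth dest: in_set_takeD)

lemma walk_drop:
  assumes "walk W E u p v" and "i < length p"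
  shows "walk W E (p ! i) (drop i p) v"
  using assms
  by (auto simp: walk_def successively_conv_nth hd_drop_conv_nth dest: in_set_dropD)

lemma walk_imp_distinct_walk:
  "walk W E u p v \<Longrightarrow> \<exists>q. walk W E u q v \<and> distinct q"
proof (induction "length p" arbitrary: p rule: less_induct)
  case less
  show ?case
  proof (cases "distinct p")
    case False
    then obtain xs ys zs y where p: "p = xs @ [y] @ ys @ [y] @ zs"
      using not_distinct_decomp by blast
    have "walk W E u (xs @ [y] @ zs) v"
      using less.prems unfolding p walk_def
      by (auto simp: successively_append_iff successively_Cons hd_append)
    then show ?thesis
      using less.hyps[of "xs @ [y] @ zs"] p by auto
  qed (use less.prems in blast)
qed

text \<open>Closing up a walk between two neighbours of \<open>x\<close> through \<open>x\<close> would produce a cycle.\<close>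

lemma tree_neighbours_separated:
  assumes "graph_tree V E" and "E x y" and "E x z" and "walk (V - {x}) E y p z"
  shows "y = z"
proof (rule ccontr)
  assume "y \<noteq> z"
  obtain q where q: "walk (V - {x}) E y q z" "distinct q"
    using walk_imp_distinct_walk[OF assms(4)] by blast
  obtain q' where q': "q = y # q'" "q' \<noteq> []"
    using q(1) \<open>y \<noteq> z\<close> by (cases q; cases "tl q") (auto simp: walk_def)
  have "E z x"
    using assms(1,3) by (auto simp: graph_tree_def simple_graph_def)
  moreover have "3 \<le> length (x # q)"
    using q' by (cases q') auto
  ultimately have "graph_cycle E (x # q)"
    using q q' assms(2) by (auto simp: graph_cycle_def walk_def)
  then show False
    using assms(1) by (auto simp: graph_tree_def)
qed

lemma graph_dist_le_walk: "walk V E u p v \<Longrightarrow> graph_dist V E u v \<le> length p - 1"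
  unfolding graph_dist_def
  by (rule Least_le, rule exI[of _ p]) (cases p; simp add: walk_def)

lemma geodesic_exists:
  assumes "connected_graph V E" and "u \<in> V" and "v \<in> V"
  shows "\<exists>p. geodesic V E u p v"
proof -
  obtain p where p: "walk V E u p v"
    using assms by (auto simp: connected_graph_def)
  then have "\<exists>k q. walk V E u q v \<and> length q = k + 1"
    by (intro exI[of _ "length p - 1"] exI[of _ p]) (auto simp: walk_def)
  from LeastI_ex[OF this] show ?thesis
    unfolding geodesic_def graph_dist_def by blast
qed

section \<open>Levels and subtrees of a rooted tree\<close>

context regular_rooted_tree
begin

abbreviation lvl :: "'v \<Rightarrow> nat" where
  "lvl \<equiv> graph_dist V E r"

lemma edge_in_V: "E x y \<Longrightarrow> x \<in> V \<and> y \<in> V \<and> x \<noteq> y \<and> E y x"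
  using tree by (simp add: graph_tree_def simple_graph_def)

lemma geodesic_from_root: "x \<in> V \<Longrightarrow> \<exists>p. geodesic V E r p x"
  using geodesic_exists[of V E r x] r_in_V tree by (simp add: graph_tree_def)

lemma lvl_0_iff:
  assumes "x \<in> V"
  shows "lvl x = 0 \<longleftrightarrow> x = r"
proof
  assume "lvl x = 0"
  then obtain p where "walk V E r p x" "length p = 1"
    using geodesic_from_root[OF assms] by (auto simp: geodesic_def)
  then show "x = r"
    by (cases p) (auto simp: walk_def)
next
  assume "x = r"
  then have "walk V E r [r] x"
    using r_in_V by (simp add: walk_def)
  from graph_dist_le_walk[OF this] show "lvl x = 0"
    by simp
qed

lemma lvl_geodesic_nth:
  assumes "geodesic V E r p x" and "i < length p"
  shows "lvl (p ! i) = i"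
proof (rule antisym)
  have p: "walk V E r p x" and len: "length p = lvl x + 1"
    using assms by (auto simp: geodesic_def)
  show "lvl (p ! i) \<le> i"
    using graph_dist_le_walk[OF walk_take[OF p assms(2)]] assms(2) by simp
  have "p ! i \<in> V"
    using p assms(2) by (auto simp: walk_def)
  then obtain q where q: "walk V E r q (p ! i)" "length q = lvl (p ! i) + 1"
    using geodesic_from_root by (auto simp: geodesic_def)
  have "lvl x \<le> length (q @ tl (drop i p)) - 1"
    by (rule graph_dist_le_walk[OF walk_append[OF q(1) walk_drop[OF p assms(2)]]])
  then show "i \<le> lvl (p ! i)"
    using q(2) len assms(2) by simp
qed

lemma lvl_step_le:
  assumes "E x y"
  shows "lvl y \<le> Suc (lvl x)"
proof -
  obtain p where p: "walk V E r p x" "length p = lvl x + 1"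
    using geodesic_from_root edge_in_V[OF assms] by (auto simp: geodesic_def)
  have "walk V E x [x, y] y"
    using assms edge_in_V[OF assms] by (simp add: walk_def)
  from graph_dist_le_walk[OF walk_append[OF p(1) this]] p(2) show ?thesis
    by simp
qed

lemma geodesic_avoids_farther_neighbour:
  assumes "geodesic V E r p y" and "E x y" and "lvl y \<le> lvl x"
  shows "walk (V - {x}) E r p y"
proof -
  have p: "walk V E r p y" and len: "length p = lvl y + 1"
    using assms by (auto simp: geodesic_def)
  have "x \<notin> set p"
  proof
    assume "x \<in> set p"
    then obtain i where i: "i < length p" "p ! i = x"
      by (auto simp: in_set_conv_nth)
    then have "i = length p - 1"
      using lvl_geodesic_nth[OF assms(1) i(1)] assms(3) len by simp
    then have "x = y"
      using i p by (auto simp: walk_def last_conv_nth)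
    then show False
      using edge_in_V[OF assms(2)] by simp
  qed
  then show ?thesis
    using p by (auto simp: walk_def)
qed

text \<open>Two neighbours of \<open>x\<close> that are not farther from the root than \<open>x\<close> are joined through the
  root by a walk avoiding \<open>x\<close>. This gives at once the uniqueness of parents and the absence of
  edges inside a level.\<close>

lemma lower_neighbour_unique:
  assumes "E x y" and "lvl y \<le> lvl x" and "E x z" and "lvl z \<le> lvl x"
  shows "y = z"
proof -
  obtain p q where "geodesic V E r p y" "geodesic V E r q z"
    using geodesic_from_root edge_in_V assms(1,3) by meson
  then have p: "walk (V - {x}) E r p y" and q: "walk (V - {x}) E r q z"
    using geodesic_avoids_farther_neighbour assms by blast+
  have "walk (V - {x}) E y (rev p) r"
    using p walk_rev tree by (auto simp: graph_tree_def)
  then have "walk (V - {x}) E y (rev p @ tl q) z"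
    using q by (rule walk_append)
  then show ?thesis
    using tree_neighbours_separated tree assms(1,3) by metis
qed

lemma parent_exists:
  assumes "x \<in> V" and "x \<noteq> r"
  shows "\<exists>y. E x y \<and> Suc (lvl y) = lvl x"
proof -
  obtain p where p: "geodesic V E r p x"
    using geodesic_from_root assms by blast
  then have w: "walk V E r p x" and len: "length p = lvl x + 1"
    by (auto simp: geodesic_def)
  have pos: "lvl x > 0"
    using assms lvl_0_iff[of x] by simp
  define y where "y = p ! (lvl x - 1)"
  have "E y (p ! lvl x)"
    using w pos len successively_nth[of E p "lvl x - 1"] by (simp add: y_def walk_def)
  moreover have "last p = x" "p \<noteq> []"
    using w by (auto simp: walk_def)
  then have "p ! lvl x = x"
    using len by (simp add: last_conv_nth)
  moreover have "lvl y = lvl x - 1"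
    using lvl_geodesic_nth[OF p, of "lvl x - 1"] len by (simp add: y_def)
  ultimately show ?thesis
    using pos edge_in_V by (intro exI[of _ y]) auto
qed

lemma edge_changes_lvl:
  assumes "E x y" and "lvl y \<le> lvl x"
  shows "Suc (lvl y) = lvl x"
proof -
  have xy: "x \<in> V" "y \<in> V" "x \<noteq> y"
    using edge_in_V[OF assms(1)] by auto
  have "x \<noteq> r"
    using assms(2) xy lvl_0_iff r_in_V by (metis le_zero_eq)
  then obtain z where "E x z" "Suc (lvl z) = lvl x"
    using parent_exists xy by blast
  then show ?thesis
    using lower_neighbour_unique[OF assms, of z] by auto
qed

text \<open>Only the parent is not a child among the neighbours of \<open>x\<close>. The root has \<open>d \<ge> 2\<close> neighbours
  and no parent, and every other vertex has \<open>d + 1 \<ge> 3\<close> neighbours.\<close>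

lemma two_children:
  assumes "x \<in> V"
  shows "\<exists>y z. y \<noteq> z \<and> E x y \<and> lvl y = Suc (lvl x) \<and> E x z \<and> lvl z = Suc (lvl x)"
proof -
  define N where "N = {w. E x w}"
  define D where "D = {w. E x w \<and> lvl w \<le> lvl x}"
  have card_N: "card N = (if x = r then d else d + 1)"
    using degree_root degree_non_root assms by (simp add: N_def graph_degree_def)
  then have fin: "finite N"
    using d_gt_1 by (intro card_ge_0_finite) auto
  have DN: "D \<subseteq> N"
    by (auto simp: D_def N_def)
  have "card D \<le> Suc 0"
    using lower_neighbour_unique finite_subset[OF DN fin]
    by (simp add: card_le_Suc0_iff_eq D_def) blast
  moreover have "D = {}" if "x = r"
    using that edge_changes_lvl lvl_0_iff r_in_V by (fastforce simp: D_def)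
  ultimately have "card D < card N - 1"
    using card_N d_gt_1 by (cases "x = r") auto
  then have "\<not> card (N - D) \<le> Suc 0"
    using card_Diff_subset[OF finite_subset[OF DN fin] DN] by simp
  then obtain y z where yz: "y \<in> N - D" "z \<in> N - D" "y \<noteq> z"
    using fin by (auto simp: card_le_Suc0_iff_eq)
  then have "E x y" "E x z" "lvl y = Suc (lvl x)" "lvl z = Suc (lvl x)"
    using lvl_step_le[of x y] lvl_step_le[of x z] by (auto simp: N_def D_def)
  then show ?thesis
    using yz(3) by blast
qed

text \<open>Sending each vertex to one of its children embeds a level into the next one and misses the
  second children, so the sizes of the levels are unbounded.\<close>

lemma large_level: "\<exists>I \<subseteq> tree_level V E r k. finite I \<and> card I = Suc k"
proof (induction k)
  case 0
  show ?case
    using r_in_V lvl_0_iff by (intro exI[of _ "{r}"]) (simp add: tree_level_def)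
next
  case (Suc k)
  then obtain I where I: "I \<subseteq> tree_level V E r k" "finite I" "card I = Suc k"
    by blast
  have "\<forall>x\<in>V. \<exists>y z. y \<noteq> z \<and> E x y \<and> lvl y = Suc (lvl x) \<and> E x z \<and> lvl z = Suc (lvl x)"
    using two_children by blast
  then obtain f g where fg: "\<And>x. x \<in> V \<Longrightarrow>
      f x \<noteq> g x \<and> E x (f x) \<and> lvl (f x) = Suc (lvl x) \<and> E x (g x) \<and> lvl (g x) = Suc (lvl x)"
    by metis
  have IV: "x \<in> V" "lvl x = k" if "x \<in> I" for x
    using that I(1) by (auto simp: tree_level_def)
  have same_parent: "x = x'"
    if "E x y" "E x' y" "lvl y = Suc (lvl x)" "lvl y = Suc (lvl x')" for x x' y
    using that lower_neighbour_unique[of y x x'] edge_in_V by auto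
  obtain x0 where x0: "x0 \<in> I"
    using I(3) by (metis card_eq_0_iff ex_in_conv nat.distinct(1))
  have inj: "inj_on f I"
  proof (rule inj_onI)
    fix x x' assume x: "x \<in> I" "x' \<in> I" "f x = f x'"
    show "x = x'"
      using same_parent[of x "f x" x'] fg[OF IV(1)[OF x(1)]] fg[OF IV(1)[OF x(2)]] x(3) by simp
  qed
  have new: "g x0 \<notin> f ` I"
  proof
    assume "g x0 \<in> f ` I"
    then obtain x where x: "x \<in> I" "g x0 = f x"
      by auto
    then have "x = x0"
      using same_parent[of x "f x" x0] fg[OF IV(1)[OF x(1)]] fg[OF IV(1)[OF x0]] by simp
    then show False
      using x fg[OF IV(1)[OF x0]] by simp
  qed
  have "insert (g x0) (f ` I) \<subseteq> tree_level V E r (Suc k)"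
  proof -
    have "f x \<in> V \<and> lvl (f x) = Suc k \<and> g x \<in> V \<and> lvl (g x) = Suc k" if "x \<in> I" for x
      using fg[OF IV(1)[OF that]] IV(2)[OF that] edge_in_V[of x "f x"] edge_in_V[of x "g x"]
      by simp
    then show ?thesis
      using x0 by (auto simp: tree_level_def)
  qed
  moreover have "card (insert (g x0) (f ` I)) = Suc (Suc k)"
    using new I card_image[OF inj] by simp
  ultimately show ?case
    using I(2) by (intro exI[of _ "insert (g x0) (f ` I)"]) simp
qed

lemma geodesic_unique:
  assumes p: "geodesic V E r p x" and q: "geodesic V E r q x"
  shows "p = q"
proof -
  have len: "length p = Suc (lvl x)" "length q = Suc (lvl x)"
    and w: "walk V E r p x" "walk V E r q x"
    using p q by (auto simp: geodesic_def)
  have "p ! (lvl x - j) = q ! (lvl x - j)" if "j \<le> lvl x" for j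
    using that
  proof (induction j)
    case 0
    have "last p = x" "last q = x" "p \<noteq> []" "q \<noteq> []"
      using w by (auto simp: walk_def)
    then show ?case
      using len by (simp add: last_conv_nth)
  next
    case (Suc j)
    define i where "i = lvl x - Suc j"
    have i: "Suc i = lvl x - j" "Suc i < length p" "Suc i < length q"
      using Suc.prems len by (auto simp: i_def)
    have eq: "p ! Suc i = q ! Suc i"
      using Suc i(1) by simp
    have "E (p ! i) (p ! Suc i)" "E (q ! i) (q ! Suc i)"
      using w i(2,3) successively_nth[of E p i] successively_nth[of E q i]
      unfolding walk_def by blast+
    moreover have "lvl (p ! i) = i" "lvl (q ! i) = i" "lvl (q ! Suc i) = Suc i"
      using lvl_geodesic_nth p q i by auto
    ultimately have "p ! i = q ! i"
      using lower_neighbour_unique[of "q ! Suc i" "p ! i" "q ! i"] eq edge_in_V by auto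
    then show ?case
      by (simp add: i_def)
  qed
  then have "p ! i = q ! i" if "i \<le> lvl x" for i
    using that by (metis diff_diff_cancel diff_le_self)
  then show ?thesis
    using len by (intro nth_equalityI) auto
qed

lemma vertex_in_own_subtree: "v \<in> V \<Longrightarrow> v \<in> subtree V E r v"
  using geodesic_from_root by (fastforce simp: subtree_def geodesic_def walk_def)

lemma ancestor_exists:
  assumes "x \<in> V" and "k \<le> lvl x"
  shows "\<exists>v \<in> tree_level V E r k. x \<in> subtree V E r v"
proof -
  obtain p where p: "geodesic V E r p x"
    using geodesic_from_root assms by blast
  then have k: "k < length p" and "set p \<subseteq> V"
    using assms(2) by (auto simp: geodesic_def walk_def)
  then have "p ! k \<in> tree_level V E r k" "x \<in> subtree V E r (p ! k)"
    using lvl_geodesic_nth[OF p] p assms(1) nth_mem[OF k]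
    by (auto simp: tree_level_def subtree_def)
  then show ?thesis
    by blast
qed

lemma subtrees_of_level_disjoint:
  "disjoint_family_on (subtree V E r) (tree_level V E r k)"
proof -
  have "u = v" if uv: "u \<in> tree_level V E r k" "v \<in> tree_level V E r k"
    and x: "x \<in> subtree V E r u" "x \<in> subtree V E r v" for u v x
  proof -
    obtain p where p: "geodesic V E r p x" "u \<in> set p" "v \<in> set p"
      using x geodesic_unique by (fastforce simp: subtree_def)
    then show ?thesis
      using lvl_geodesic_nth[OF p(1)] uv by (auto simp: tree_level_def in_set_conv_nth)
  qed
  then show ?thesis
    by (auto simp: disjoint_family_on_def)
qed

section \<open>Automorphisms and rigid stabilizers\<close>

lemma inverse_in_tree_Aut:
  assumes "g \<in> carrier (tree_Aut V E r)"
  shows "restrict (inv_into V g) V \<in> carrier (tree_Aut V E r)"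
proof -
  have g: "g \<in> Bij V" "g r = r" and pres: "\<And>u v. u \<in> V \<Longrightarrow> v \<in> V \<Longrightarrow> E (g u) (g v) = E u v"
    using assms by (auto simp: tree_Aut_def)
  have bij: "bij_betw g V V"
    using g by (simp add: Bij_def)
  have "inv_into V g x \<in> V" "g (inv_into V g x) = x" if "x \<in> V" for x
    using that bij Bij_inv_into_mem[OF g(1)] by (auto simp: bij_betw_inv_into_right)
  then show ?thesis
    using pres[of "inv_into V g u" "inv_into V g v" for u v] restrict_inv_into_Bij[OF g(1)]
      bij_betw_inv_into_left[OF bij r_in_V] g(2) r_in_V
    by (simp add: tree_Aut_def) metis
qed

lemma tree_Aut_subgroup_BijGroup:
  "subgroup (carrier (tree_Aut V E r)) (BijGroup V)"
proof (rule group.subgroupI[OF group_BijGroup])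
  show "carrier (tree_Aut V E r) \<subseteq> carrier (BijGroup V)"
    by (auto simp: tree_Aut_def BijGroup_def)
  have "restrict (\<lambda>x. x) V \<in> carrier (tree_Aut V E r)"
    using id_Bij r_in_V by (auto simp: tree_Aut_def)
  then show "carrier (tree_Aut V E r) \<noteq> {}"
    by blast
  show "inv\<^bsub>BijGroup V\<^esub> g \<in> carrier (tree_Aut V E r)" if "g \<in> carrier (tree_Aut V E r)" for g
    using inverse_in_tree_Aut[OF that] that inv_BijGroup[of g V] by (simp add: tree_Aut_def)
  show "g \<otimes>\<^bsub>BijGroup V\<^esub> h \<in> carrier (tree_Aut V E r)"
    if "g \<in> carrier (tree_Aut V E r)" "h \<in> carrier (tree_Aut V E r)" for g h
    using that compose_Bij[of g V h] r_in_V Bij_imp_funcset[of h V]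
    by (auto simp: tree_Aut_def BijGroup_def compose_eq Pi_iff)
qed

lemma tree_Aut_lvl_le:
  assumes "g \<in> carrier (tree_Aut V E r)" and "x \<in> V"
  shows "lvl (g x) \<le> lvl x"
proof -
  have g: "g \<in> V \<rightarrow> V" "g r = r" and pres: "\<And>u v. u \<in> V \<Longrightarrow> v \<in> V \<Longrightarrow> E (g u) (g v) = E u v"
    using assms by (auto simp: tree_Aut_def Bij_imp_funcset)
  obtain p where p: "walk V E r p x" "length p = lvl x + 1"
    using geodesic_from_root assms by (auto simp: geodesic_def)
  have "successively (\<lambda>u v. E (g u) (g v)) p"
    using p(1) pres by (auto simp: walk_def intro: successively_mono)
  then have "walk V E r (map g p) (g x)"
    using p(1) g by (auto simp: walk_def successively_map hd_map last_map)
  from graph_dist_le_walk[OF this] p(2) show ?thesis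
    by simp
qed

lemma tree_Aut_lvl:
  assumes "g \<in> carrier (tree_Aut V E r)" and "x \<in> V"
  shows "lvl (g x) = lvl x"
proof (rule antisym)
  have g: "bij_betw g V V"
    using assms(1) by (simp add: tree_Aut_def Bij_def)
  then have "g x \<in> V"
    using assms(2) by (auto simp: bij_betw_def)
  then show "lvl x \<le> lvl (g x)"
    using tree_Aut_lvl_le[OF inverse_in_tree_Aut[OF assms(1)], of "g x"]
      bij_betw_inv_into_left[OF g assms(2)] by simp
qed (rule tree_Aut_lvl_le[OF assms])

text \<open>For \<open>x\<close> at or below the level of \<open>v\<close>, but not in the subtree at \<open>v\<close>, this is the
  definition of the rigid stabilizer. A bijection of a level that fixes all vertices but one fixes
  that one as well, and an automorphism fixing a vertex fixes its unique parent. Since every vertex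
  has a child, going up from the level of \<open>v\<close> shows that all vertices closer to the root than \<open>v\<close>
  are fixed, too.\<close>

lemma rist_fixes_outside_subtree:
  assumes G: "G \<subseteq> carrier (tree_Aut V E r)" and v: "v \<in> V" and g: "g \<in> rist V E r G v"
    and x: "x \<in> V" "x \<notin> subtree V E r v"
  shows "g x = x"
proof -
  have gA: "g \<in> carrier (tree_Aut V E r)"
    using g G by (auto simp: rist_def)
  then have bij: "bij_betw g V V"
    and pres: "\<And>u v. u \<in> V \<Longrightarrow> v \<in> V \<Longrightarrow> E (g u) (g v) = E u v"
    by (auto simp: tree_Aut_def Bij_def)
  have gV: "g y \<in> V" if "y \<in> V" for y
    using bij that by (auto simp: bij_betw_def)
  have fix_sub: "g y = y"
    if "w \<in> tree_level V E r (lvl v)" "w \<noteq> v" "y \<in> subtree V E r w" for w y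
    using that g by (auto simp: rist_def subtree_Stab_def)
  have fix_other: "g w = w" if "w \<in> V" "lvl w = lvl v" "w \<noteq> v" for w
    using fix_sub[of w w] vertex_in_own_subtree that by (simp add: tree_level_def)
  have "g v = v"
  proof (rule ccontr)
    assume "g v \<noteq> v"
    then have "g (g v) = g v"
      using fix_other[of "g v"] gV[OF v] tree_Aut_lvl[OF gA v] by simp
    then show False
      using \<open>g v \<noteq> v\<close> bij v gV[OF v] by (auto simp: bij_betw_def inj_on_def)
  qed
  with fix_other have fix_level: "g w = w" if "w \<in> V" "lvl w = lvl v" for w
    using that by blast
  have fix_above: "g y = y" if "y \<in> V" "lvl y + j = lvl v" for j y
    using that
  proof (induction j arbitrary: y)
    case 0
    then show ?case
      using fix_level by simp
  next
    case (Suc j)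
    obtain z where z: "E y z" "lvl z = Suc (lvl y)"
      using two_children[OF Suc.prems(1)] by blast
    have "g z = z"
      using Suc z edge_in_V by simp
    then have "E z (g y)"
      using pres[of z y] z edge_in_V by auto
    then show ?case
      using lower_neighbour_unique[of z "g y" y] z edge_in_V tree_Aut_lvl[OF gA Suc.prems(1)]
      by simp
  qed
  show ?thesis
  proof (cases "lvl v \<le> lvl x")
    case True
    then obtain w where "w \<in> tree_level V E r (lvl v)" "x \<in> subtree V E r w"
      using ancestor_exists x by blast
    then show ?thesis
      using fix_sub x(2) by blast
  next
    case False
    then show ?thesis
      using fix_above[of x "lvl v - lvl x"] x(1) by simp
  qed
qed

end

section \<open>Alternating sums in the group algebra\<close>

lemma alternating_sum_Pow_eq_0:
  fixes F :: "'i set \<Rightarrow> complex"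
  assumes "finite I" and "i \<in> I" and inv: "\<And>S. S \<subseteq> I - {i} \<Longrightarrow> F (insert i S) = F S"
  shows "(\<Sum>S\<in>Pow I. (-1) ^ card S * F S) = 0"
proof -
  define J where "J = I - {i}"
  have J: "I = insert i J" "i \<notin> J" "finite J"
    using assms by (auto simp: J_def)
  have inj: "inj_on (insert i) (Pow J)"
    using J(2) by (auto simp: inj_on_def)
  have "(\<Sum>S\<in>Pow I. (-1) ^ card S * F S)
      = (\<Sum>S\<in>Pow J. (-1) ^ card S * F S) + (\<Sum>S\<in>insert i ` Pow J. (-1) ^ card S * F S)"
    unfolding J(1) Pow_insert using J by (intro sum.union_disjoint) auto
  also have "(\<Sum>S\<in>insert i ` Pow J. (-1) ^ card S * F S)
      = (\<Sum>S\<in>Pow J. (-1) ^ card (insert i S) * F (insert i S))"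
    using inj by (simp add: sum.reindex)
  also have "\<dots> = (\<Sum>S\<in>Pow J. - ((-1) ^ card S * F S))"
  proof (rule sum.cong)
    fix S assume "S \<in> Pow J"
    then have "finite S" "i \<notin> S" "S \<subseteq> I - {i}"
      using J(2,3) by (auto simp: J_def[symmetric] intro: finite_subset)
    then show "(-1) ^ card (insert i S) * F (insert i S) = - ((-1) ^ card S * F S)"
      using inv by simp
  qed simp
  finally show ?thesis
    by (simp add: sum_negf)
qed

lemma sum_keys_sum_single:
  fixes c :: "'s \<Rightarrow> complex" and u :: "'s \<Rightarrow> 'g"
  assumes "finite A"
  defines "a \<equiv> (\<Sum>s\<in>A. Poly_Mapping.single (u s) (c s))"
  shows "(\<Sum>g\<in>Poly_Mapping.keys a. Poly_Mapping.lookup a g * F g) = (\<Sum>s\<in>A. c s * F (u s))"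
proof -
  have "Poly_Mapping.keys a \<subseteq> (\<Union>s\<in>A. Poly_Mapping.keys (Poly_Mapping.single (u s) (c s)))"
    unfolding a_def by (rule keys_sum)
  also have "\<dots> \<subseteq> u ` A"
    by (auto split: if_splits)
  finally have "(\<Sum>g\<in>Poly_Mapping.keys a. Poly_Mapping.lookup a g * F g)
      = (\<Sum>g\<in>u ` A. Poly_Mapping.lookup a g * F g)"
    using assms(1) by (intro sum.mono_neutral_left) (auto simp: in_keys_iff)
  also have "\<dots> = (\<Sum>g\<in>u ` A. \<Sum>s\<in>A. (if u s = g then c s * F g else 0))"
    unfolding a_def lookup_sum lookup_single sum_distrib_right
    by (intro sum.cong) (auto simp: when_def)
  also have "\<dots> = (\<Sum>s\<in>A. \<Sum>g\<in>u ` A. (if u s = g then c s * F g else 0))"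
    by (rule sum.swap)
  also have "\<dots> = (\<Sum>s\<in>A. c s * F (u s))"
    using assms(1) by (intro sum.cong refl) (simp add: sum.delta')
  finally show ?thesis .
qed

section \<open>Elements with disjoint supports\<close>

text \<open>The product of the \<open>\<gamma> i\<close>, described by its values; the order of the factors does not matter,
  since the supports are disjoint.\<close>

lemma product_of_disjointly_supported:
  assumes G: "subgroup G (BijGroup V)" and "finite I" and "\<And>i. i \<in> I \<Longrightarrow> \<gamma> i \<in> G"
    and "disjoint_family_on U I"
    and "\<And>i x. i \<in> I \<Longrightarrow> x \<in> V \<Longrightarrow> x \<notin> U i \<Longrightarrow> \<gamma> i x = x"
  shows "\<exists>h\<in>G. \<forall>x\<in>V. (\<forall>i\<in>I. x \<in> U i \<longrightarrow> h x = \<gamma> i x) \<and> ((\<forall>i\<in>I. x \<notin> U i) \<longrightarrow> h x = x)"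
  using assms(2-)
proof (induction I)
  case empty
  have "\<one>\<^bsub>BijGroup V\<^esub> \<in> G"
    using G by (rule subgroup.one_closed)
  then show ?case
    by (intro bexI[of _ "\<one>\<^bsub>BijGroup V\<^esub>"]) (simp_all add: BijGroup_def)
next
  case (insert j I)
  have "disjoint_family_on U I"
    using insert.prems(2) by (rule disjoint_family_on_mono[rotated]) auto
  then obtain h where h: "h \<in> G" "\<And>x i. x \<in> V \<Longrightarrow> i \<in> I \<Longrightarrow> x \<in> U i \<Longrightarrow> h x = \<gamma> i x"
    "\<And>x. x \<in> V \<Longrightarrow> (\<forall>i\<in>I. x \<notin> U i) \<Longrightarrow> h x = x"
  proof -
    have "\<exists>h\<in>G. \<forall>x\<in>V. (\<forall>i\<in>I. x \<in> U i \<longrightarrow> h x = \<gamma> i x) \<and> ((\<forall>i\<in>I. x \<notin> U i) \<longrightarrow> h x = x)"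
      by (rule insert.IH) (use insert.prems(1,3) \<open>disjoint_family_on U I\<close> in auto)
    then show ?thesis
      using that by blast
  qed
  have GB: "G \<subseteq> Bij V"
    using subgroup.subset[OF G] by (simp add: BijGroup_def)
  have j: "\<gamma> j \<in> G"
    using insert.prems by simp
  have prod: "\<gamma> j \<otimes>\<^bsub>BijGroup V\<^esub> h = compose V (\<gamma> j) h"
    using GB j h(1) by (auto simp: BijGroup_def)
  have "compose V (\<gamma> j) h \<in> G"
    using subgroup.m_closed[OF G j h(1)] by (simp add: prod)
  moreover have "compose V (\<gamma> j) h x = \<gamma> i x" if x: "x \<in> V" "x \<in> U i" "i \<in> insert j I" for i x
  proof (cases "i = j")
    case True
    then have "\<forall>i\<in>I. x \<notin> U i"
      using insert.prems(2) insert.hyps(2) x by (force simp: disjoint_family_on_def)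
    then show ?thesis
      using h(3) x True by (simp add: compose_eq)
  next
    case False
    then have i: "i \<in> I"
      using x by simp
    have bij: "bij_betw (\<gamma> i) V V"
      using insert.prems(1) i GB by (auto simp: Bij_def)
    then have gx: "\<gamma> i x \<in> V"
      using x by (auto simp: bij_betw_def)
    \<comment> \<open>A bijection that fixes the complement of a set pointwise preserves that set.\<close>
    have "\<gamma> i x \<in> U i"
    proof (rule ccontr)
      assume "\<gamma> i x \<notin> U i"
      moreover from this have "\<gamma> i (\<gamma> i x) = \<gamma> i x"
        using insert.prems(3) i gx by blast
      then have "\<gamma> i x = x"
        using bij x gx by (auto simp: bij_betw_def inj_on_def)
      ultimately show False
        using x by simp
    qed
    then have "\<gamma> i x \<notin> U j"
      using insert.prems(2) i False by (auto simp: disjoint_family_on_def)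
    then have "\<gamma> j (\<gamma> i x) = \<gamma> i x"
      using insert.prems(3) gx by blast
    then show ?thesis
      using h(2) x i by (simp add: compose_eq)
  qed
  moreover have "compose V (\<gamma> j) h x = x" if "x \<in> V" "\<forall>i\<in>insert j I. x \<notin> U i" for x
    using that h(3) insert.prems(3) by (simp add: compose_eq)
  ultimately show ?case
    by (intro bexI[of _ "compose V (\<gamma> j) h"]) auto
qed

text \<open>The element is the expanded product of the \<open>1 - (\<gamma> i)\<inverse>\<close>. Its terms with \<open>i \<in> S\<close> and with
  \<open>i \<notin> S\<close> cancel on every tuple that avoids \<open>U i\<close>. The inverses make the representation evaluate
  vectors at translates by the products of the \<open>\<gamma> i\<close> themselves, because it acts through inverses.\<close>

lemma exists_annihilator:
  fixes V :: "'v set" and G :: "('v \<Rightarrow> 'v) set"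
  assumes G: "subgroup G (BijGroup V)" and I: "finite I" "n < card I"
    and \<gamma>: "\<And>i. i \<in> I \<Longrightarrow> \<gamma> i \<in> G" "\<And>i. i \<in> I \<Longrightarrow> \<gamma> i \<noteq> \<one>\<^bsub>BijGroup V\<^esub>"
    and U: "disjoint_family_on U I"
    and supp: "\<And>i x. i \<in> I \<Longrightarrow> x \<in> V \<Longrightarrow> x \<notin> U i \<Longrightarrow> \<gamma> i x = x"
  defines "H \<equiv> (BijGroup V)\<lparr>carrier := G\<rparr>"
  shows "\<exists>a \<in> group_algebra H. Poly_Mapping.lookup a \<one>\<^bsub>H\<^esub> = 1 \<and>
           algebra_rep (tree_rep_tensor H V n) a = algebra_rep (tree_rep_tensor H V n) 0"
proof -
  have grp: "group H"
    unfolding H_def using G group_BijGroup by (rule subgroup.subgroup_is_group)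
  have GB: "G \<subseteq> Bij V"
    using subgroup.subset[OF G] by (simp add: BijGroup_def)
  have carrier [simp]: "carrier H = G"
    by (simp add: H_def)
  have one: "\<one>\<^bsub>H\<^esub> = (\<lambda>x\<in>V. x)" and one_Bij: "\<one>\<^bsub>BijGroup V\<^esub> = (\<lambda>x\<in>V. x)"
    by (simp_all add: H_def BijGroup_def)
  define is_prod where "is_prod S h \<longleftrightarrow> h \<in> G \<and> (\<forall>x\<in>V.
      (\<forall>i\<in>S. x \<in> U i \<longrightarrow> h x = \<gamma> i x) \<and> ((\<forall>i\<in>S. x \<notin> U i) \<longrightarrow> h x = x))" for S h
  have "\<forall>S\<in>Pow I. \<exists>h. is_prod S h"
  proof
    fix S assume "S \<in> Pow I"
    then have S: "S \<subseteq> I"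
      by simp
    have "finite S" "disjoint_family_on U S"
      using S I(1) U by (auto intro: finite_subset disjoint_family_on_mono)
    then have "\<exists>h\<in>G. \<forall>x\<in>V.
        (\<forall>i\<in>S. x \<in> U i \<longrightarrow> h x = \<gamma> i x) \<and> ((\<forall>i\<in>S. x \<notin> U i) \<longrightarrow> h x = x)"
      using S \<gamma>(1) supp by (intro product_of_disjointly_supported[OF G]) auto
    then show "\<exists>h. is_prod S h"
      unfolding is_prod_def by blast
  qed
  from bchoice[OF this] obtain q where "\<And>S. S \<subseteq> I \<Longrightarrow> is_prod S (q S)"
    by blast
  then have q: "\<And>S. S \<subseteq> I \<Longrightarrow> q S \<in> G"
    and q_in: "\<And>S x i. S \<subseteq> I \<Longrightarrow> x \<in> V \<Longrightarrow> i \<in> S \<Longrightarrow> x \<in> U i \<Longrightarrow> q S x = \<gamma> i x"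
    and q_out: "\<And>S x. S \<subseteq> I \<Longrightarrow> x \<in> V \<Longrightarrow> (\<forall>i\<in>S. x \<notin> U i) \<Longrightarrow> q S x = x"
    by (auto simp: is_prod_def)
  have q_one: "q S = \<one>\<^bsub>H\<^esub> \<longleftrightarrow> S = {}" if S: "S \<subseteq> I" for S
  proof
    assume eq: "q S = \<one>\<^bsub>H\<^esub>"
    show "S = {}"
    proof (rule ccontr)
      assume "S \<noteq> {}"
      then obtain i where i: "i \<in> S" "i \<in> I"
        using S by blast
      have "\<gamma> i x = x" if "x \<in> V" for x
        using q_in[OF S that i(1)] supp[OF i(2) that] eq that by (cases "x \<in> U i") (auto simp: one)
      then have "\<gamma> i = \<one>\<^bsub>BijGroup V\<^esub>"
        using \<gamma>(1)[OF i(2)] GB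
        by (auto simp: one_Bij fun_eq_iff Bij_def extensional_def subset_iff)
      then show False
        using \<gamma>(2) i(2) by blast
    qed
  next
    assume "S = {}"
    then show "q S = \<one>\<^bsub>H\<^esub>"
      using q_out[of S] q[of S] S GB
      by (auto simp: one fun_eq_iff Bij_def extensional_def subset_iff)
  qed
  define a :: "('v \<Rightarrow> 'v) \<Rightarrow>\<^sub>0 complex" where
    "a = (\<Sum>S\<in>Pow I. Poly_Mapping.single (inv\<^bsub>H\<^esub> (q S)) ((-1) ^ card S))"
  have "Poly_Mapping.keys a
      \<subseteq> (\<Union>S\<in>Pow I. Poly_Mapping.keys (Poly_Mapping.single (inv\<^bsub>H\<^esub> (q S)) ((-1) ^ card S :: complex)))"
    unfolding a_def by (rule keys_sum)
  also have "\<dots> \<subseteq> G"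
    using q group.inv_closed[OF grp] by (auto split: if_splits)
  finally have mem: "a \<in> group_algebra H"
    by (simp add: group_algebra_def)
  have "Poly_Mapping.lookup a \<one>\<^bsub>H\<^esub>
      = (\<Sum>S\<in>Pow I. if S = {} then (-1) ^ card S else 0)"
    unfolding a_def lookup_sum
  proof (rule sum.cong)
    fix S assume "S \<in> Pow I"
    then have "inv\<^bsub>H\<^esub> (q S) = \<one>\<^bsub>H\<^esub> \<longleftrightarrow> S = {}"
      using q_one[of S] q[of S] group.inv_eq_1_iff[OF grp, of "q S"] by simp
    then show "Poly_Mapping.lookup (Poly_Mapping.single (inv\<^bsub>H\<^esub> (q S)) ((-1) ^ card S)) \<one>\<^bsub>H\<^esub>
        = (if S = {} then (-1) ^ card S else 0 :: complex)"
      by (simp add: lookup_single when_def)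
  qed simp
  also have "\<dots> = 1"
    using I(1) by (simp add: sum.delta)
  finally have coeff: "Poly_Mapping.lookup a \<one>\<^bsub>H\<^esub> = 1" .
  have zero: "(\<Sum>g\<in>Poly_Mapping.keys a.
      Poly_Mapping.lookup a g * hop (tree_rep_tensor H V n) g \<xi> xs) = 0" for \<xi> xs
  proof (cases "xs \<in> nlists n V")
    case True
    then have xs: "length xs = n" "set xs \<subseteq> V"
      by auto
    have "\<exists>i\<in>I. U i \<inter> set xs = {}"
    proof (rule ccontr)
      assume "\<not> (\<exists>i\<in>I. U i \<inter> set xs = {})"
      then have "\<forall>i\<in>I. \<exists>x. x \<in> U i \<inter> set xs"
        by blast
      from bchoice[OF this] obtain y where y: "\<And>i. i \<in> I \<Longrightarrow> y i \<in> U i \<inter> set xs"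
        by blast
      then have "inj_on y I"
        using U by (fastforce simp: inj_on_def disjoint_family_on_def)
      then have "card I \<le> card (set xs)"
        using y by (intro card_inj_on_le[of y]) auto
      then show False
        using card_length[of xs] xs(1) I(2) by simp
    qed
    then obtain i where i: "i \<in> I" "U i \<inter> set xs = {}"
      by blast
    have same: "map (q (insert i S)) xs = map (q S) xs" if S: "S \<subseteq> I - {i}" for S
    proof (rule map_cong)
      fix x assume x: "x \<in> set xs"
      have xV: "x \<in> V" and xU: "x \<notin> U i"
        using x xs i(2) by auto
      have sub: "insert i S \<subseteq> I" "S \<subseteq> I"
        using S i(1) by auto
      show "q (insert i S) x = q S x"
      proof (cases "\<exists>j\<in>S. x \<in> U j")
        case True
        then show ?thesis
          using q_in[OF sub(1) xV] q_in[OF sub(2) xV] by auto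
      next
        case False
        then show ?thesis
          using q_out[OF sub(1) xV] q_out[OF sub(2) xV] xU by auto
      qed
    qed simp
    have "(\<Sum>g\<in>Poly_Mapping.keys a. Poly_Mapping.lookup a g * \<xi> (map (inv\<^bsub>H\<^esub> g) xs))
        = (\<Sum>S\<in>Pow I. (-1) ^ card S * \<xi> (map (inv\<^bsub>H\<^esub> (inv\<^bsub>H\<^esub> (q S))) xs))"
      unfolding a_def using I(1) by (intro sum_keys_sum_single) simp
    also have "\<dots> = (\<Sum>S\<in>Pow I. (-1) ^ card S * \<xi> (map (q S) xs))"
      using q group.inv_inv[OF grp] by (intro sum.cong) auto
    also have "\<dots> = 0"
      using I(1) i(1) by (rule alternating_sum_Pow_eq_0) (simp only: same)
    finally show ?thesis
      using True by (simp add: tree_rep_tensor_def permutation_rep_def)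
  qed (simp add: tree_rep_tensor_def permutation_rep_def)
  have "algebra_rep (tree_rep_tensor H V n) a = algebra_rep (tree_rep_tensor H V n) 0"
    unfolding algebra_rep_def by (simp add: zero)
  with mem coeff show ?thesis
    by blast
qed

section \<open>Kernels of permutation representations and weak containment\<close>

lemma ell2_mult_summable:
  assumes "\<xi> \<in> ell2 X" and "\<eta> \<in> ell2 X"
  shows "(\<lambda>x. \<xi> x * cnj (\<eta> x)) summable_on X"
proof -
  have "(\<lambda>x. (cmod (\<xi> x))\<^sup>2 + (cmod (\<eta> x))\<^sup>2) summable_on X"
    using assms by (intro summable_on_add) (auto simp: ell2_def)
  moreover have "norm (\<xi> x * cnj (\<eta> x)) \<le> (cmod (\<xi> x))\<^sup>2 + (cmod (\<eta> x))\<^sup>2" for x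
  proof -
    have "2 * cmod (\<xi> x) * cmod (\<eta> x) \<le> (cmod (\<xi> x))\<^sup>2 + (cmod (\<eta> x))\<^sup>2"
      by (rule sum_squares_bound)
    moreover have "0 \<le> cmod (\<xi> x) * cmod (\<eta> x)"
      by simp
    ultimately show ?thesis
      unfolding norm_mult complex_mod_cnj by linarith
  qed
  ultimately show ?thesis
    by (rule abs_summable_summable[OF abs_summable_on_comparison_test'])
qed

lemma has_sum_finite_sum:
  fixes f :: "'i \<Rightarrow> 'x \<Rightarrow> complex"
  assumes "finite K" and "\<And>i. i \<in> K \<Longrightarrow> (f i has_sum s i) X"
  shows "((\<lambda>x. \<Sum>i\<in>K. f i x) has_sum (\<Sum>i\<in>K. s i)) X"
  using assms
proof (induction K)
  case (insert j K)
  have "((\<lambda>x. f j x + (\<Sum>i\<in>K. f i x)) has_sum (s j + (\<Sum>i\<in>K. s i))) X"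
    by (rule has_sum_add) (use insert in auto)
  then show ?case
    using insert.hyps by simp
qed simp

lemma permutation_rep_hop_in_ell2:
  assumes "\<xi> \<in> ell2 X" and "bij_betw (act (inv\<^bsub>G\<^esub> g)) X X"
  shows "hop (permutation_rep G X act) g \<xi> \<in> ell2 X"
proof -
  have "(\<lambda>x. (cmod (\<xi> (act (inv\<^bsub>G\<^esub> g) x)))\<^sup>2) summable_on X"
    using assms summable_on_reindex_bij_betw[OF assms(2), of "\<lambda>x. (cmod (\<xi> x))\<^sup>2"]
    by (simp add: ell2_def)
  then have "(\<lambda>x. (cmod (hop (permutation_rep G X act) g \<xi> x))\<^sup>2) summable_on X"
    by (rule summable_on_cong[THEN iffD1, rotated]) (simp add: permutation_rep_def)
  then show ?thesis
    by (simp add: ell2_def permutation_rep_def)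
qed

lemma kernel_element_matrix_coefficients:
  fixes G :: "('g, 'm) monoid_scheme" and X :: "'x set"
    and act :: "'g \<Rightarrow> 'x \<Rightarrow> 'x" and a :: "'g \<Rightarrow>\<^sub>0 complex"
  defines "\<pi> \<equiv> permutation_rep G X act"
  assumes G: "group G" and act: "\<And>g. g \<in> carrier G \<Longrightarrow> bij_betw (act g) X X"
    and a: "a \<in> group_algebra G" and ker: "algebra_rep \<pi> a = algebra_rep \<pi> 0"
    and \<nu>: "\<nu> \<in> ell2 X"
  shows "(\<Sum>g\<in>Poly_Mapping.keys a. Poly_Mapping.lookup a g * hinner \<pi> (hop \<pi> g \<nu>) \<nu>) = 0"
proof -
  have kG: "g \<in> carrier G" if "g \<in> Poly_Mapping.keys a" for g
    using a that by (auto simp: group_algebra_def)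
  have hops: "hop \<pi> g \<nu> \<in> ell2 X" if "g \<in> Poly_Mapping.keys a" for g
    unfolding \<pi>_def using \<nu> act group.inv_closed[OF G] kG[OF that]
    by (intro permutation_rep_hop_in_ell2) auto
  have hsp: "\<nu> \<in> hspace \<pi>" and hin: "hinner \<pi> = ell2_inner X"
    using \<nu> by (simp_all add: \<pi>_def permutation_rep_def)
  have op: "(\<Sum>g\<in>Poly_Mapping.keys a. Poly_Mapping.lookup a g * hop \<pi> g \<nu> x) = 0" for x
    using fun_cong[OF fun_cong[OF ker, of \<nu>], of x] hsp by (simp add: algebra_rep_def)
  have "((\<lambda>x. \<Sum>g\<in>Poly_Mapping.keys a. Poly_Mapping.lookup a g * (hop \<pi> g \<nu> x * cnj (\<nu> x)))
      has_sum (\<Sum>g\<in>Poly_Mapping.keys a. Poly_Mapping.lookup a g * ell2_inner X (hop \<pi> g \<nu>) \<nu>)) X"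
    unfolding ell2_inner_def
    by (intro has_sum_finite_sum has_sum_cmult_right has_sum_infsum ell2_mult_summable hops \<nu>) simp_all
  moreover have "(\<Sum>g\<in>Poly_Mapping.keys a. Poly_Mapping.lookup a g * (hop \<pi> g \<nu> x * cnj (\<nu> x))) = 0"
    for x
  proof -
    have "(\<Sum>g\<in>Poly_Mapping.keys a. Poly_Mapping.lookup a g * (hop \<pi> g \<nu> x * cnj (\<nu> x)))
        = (\<Sum>g\<in>Poly_Mapping.keys a. Poly_Mapping.lookup a g * hop \<pi> g \<nu> x) * cnj (\<nu> x)"
      by (simp add: sum_distrib_right mult.assoc)
    then show ?thesis
      by (simp add: op)
  qed
  ultimately have "((\<lambda>x. 0) has_sum
      (\<Sum>g\<in>Poly_Mapping.keys a. Poly_Mapping.lookup a g * ell2_inner X (hop \<pi> g \<nu>) \<nu>)) X"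
    by simp
  from infsumI[OF this] show ?thesis
    by (simp add: hin)
qed

lemma delta_one_matrix_coefficient:
  assumes G: "group G" and g: "g \<in> carrier G"
  defines "\<delta> \<equiv> (\<lambda>h. if h = \<one>\<^bsub>G\<^esub> then 1 else 0 :: complex)"
  shows "\<delta> \<in> hspace (regular_rep G)"
    and "hinner (regular_rep G) (hop (regular_rep G) g \<delta>) \<delta> = (if g = \<one>\<^bsub>G\<^esub> then 1 else 0)"
proof -
  interpret group G by (rule G)
  have "(\<lambda>h. (cmod (\<delta> h))\<^sup>2) summable_on carrier G \<longleftrightarrow> (\<lambda>h. (cmod (\<delta> h))\<^sup>2) summable_on {\<one>\<^bsub>G\<^esub>}"
    by (rule summable_on_cong_neutral) (auto simp: \<delta>_def)
  then show "\<delta> \<in> hspace (regular_rep G)"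
    by (auto simp: regular_rep_def permutation_rep_def ell2_def \<delta>_def)
  have "hinner (regular_rep G) (hop (regular_rep G) g \<delta>) \<delta>
      = (\<Sum>\<^sub>\<infinity>h\<in>carrier G. \<delta> (inv\<^bsub>G\<^esub> g \<otimes>\<^bsub>G\<^esub> h) * cnj (\<delta> h))"
    unfolding regular_rep_def permutation_rep_def ell2_inner_def hilbert_rep.simps
    by (rule infsum_cong) simp
  also have "\<dots> = (\<Sum>\<^sub>\<infinity>h\<in>{\<one>\<^bsub>G\<^esub>}. \<delta> (inv\<^bsub>G\<^esub> g \<otimes>\<^bsub>G\<^esub> h) * cnj (\<delta> h))"
    by (rule infsum_cong_neutral) (auto simp: \<delta>_def)
  also have "\<dots> = (if g = \<one>\<^bsub>G\<^esub> then 1 else 0)"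
    using g by (simp add: \<delta>_def)
  finally show "hinner (regular_rep G) (hop (regular_rep G) g \<delta>) \<delta>
      = (if g = \<one>\<^bsub>G\<^esub> then 1 else 0)" .
qed

text \<open>Summing the differences of the matrix coefficients, weighted by the coefficients of \<open>a\<close>,
  leaves exactly the coefficient of \<open>a\<close> at the neutral element, so these differences cannot all
  be small.\<close>

lemma kernel_element_obstructs_weak_containment:
  fixes G :: "('g, 'm) monoid_scheme" and X :: "'x set"
    and act :: "'g \<Rightarrow> 'x \<Rightarrow> 'x" and a :: "'g \<Rightarrow>\<^sub>0 complex"
  defines "\<pi> \<equiv> permutation_rep G X act"
  assumes G: "group G" and act: "\<And>g. g \<in> carrier G \<Longrightarrow> bij_betw (act g) X X"
    and a: "a \<in> group_algebra G" and ker: "algebra_rep \<pi> a = algebra_rep \<pi> 0"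
    and coeff: "Poly_Mapping.lookup a \<one>\<^bsub>G\<^esub> \<noteq> 0"
  shows "\<not> weakly_contains G \<pi> (regular_rep G)"
proof
  assume wc: "weakly_contains G \<pi> (regular_rep G)"
  define K where "K = Poly_Mapping.keys a"
  define c where "c = Poly_Mapping.lookup a"
  define \<delta> :: "'g \<Rightarrow> complex" where "\<delta> = (\<lambda>h. if h = \<one>\<^bsub>G\<^esub> then 1 else 0)"
  define B where "B = (\<Sum>g\<in>K. cmod (c g))"
  have K: "finite K" "K \<subseteq> carrier G" "\<one>\<^bsub>G\<^esub> \<in> K"
    using a coeff by (auto simp: K_def group_algebra_def in_keys_iff)
  have c1: "cmod (c \<one>\<^bsub>G\<^esub>) > 0"
    using coeff by (simp add: c_def)
  have "cmod (c \<one>\<^bsub>G\<^esub>) \<le> B"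
    unfolding B_def using K by (intro member_le_sum) auto
  with c1 have B: "B > 0"
    by linarith
  \<comment> \<open>Half of \<open>cmod (c \<one>) / B\<close>, so that the weighted sum of the errors stays strictly below
    \<open>cmod (c \<one>)\<close>.\<close>
  define \<epsilon> where "\<epsilon> = cmod (c \<one>\<^bsub>G\<^esub>) / (2 * B)"
  have "\<epsilon> > 0"
    using c1 B by (simp add: \<epsilon>_def)
  moreover have "\<delta> \<in> hspace (regular_rep G)"
    unfolding \<delta>_def using delta_one_matrix_coefficient(1)[OF G group.is_monoid[OF G, THEN monoid.one_closed]] .
  ultimately obtain \<nu>s where \<nu>s: "set \<nu>s \<subseteq> hspace \<pi>"
    and close: "\<forall>g\<in>K. cmod (hinner (regular_rep G) (hop (regular_rep G) g \<delta>) \<delta>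
                   - (\<Sum>\<nu>\<leftarrow>\<nu>s. hinner \<pi> (hop \<pi> g \<nu>) \<nu>)) < \<epsilon>"
    using wc[unfolded weakly_contains_def, rule_format, of \<epsilon> \<delta> K] K(1,2) by blast
  define s where "s g = (\<Sum>\<nu>\<leftarrow>\<nu>s. hinner \<pi> (hop \<pi> g \<nu>) \<nu>)" for g
  have reg: "hinner (regular_rep G) (hop (regular_rep G) g \<delta>) \<delta> = (if g = \<one>\<^bsub>G\<^esub> then 1 else 0)"
    if "g \<in> K" for g
    unfolding \<delta>_def using delta_one_matrix_coefficient(2)[OF G] K that by blast
  have "(\<Sum>g\<in>K. c g * (\<Sum>\<nu>\<leftarrow>ws. hinner \<pi> (hop \<pi> g \<nu>) \<nu>)) = 0" if "set ws \<subseteq> hspace \<pi>" for ws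
    using that
  proof (induction ws)
    case (Cons w ws)
    then have "w \<in> ell2 X"
      by (simp add: \<pi>_def permutation_rep_def)
    then have "(\<Sum>g\<in>K. c g * hinner \<pi> (hop \<pi> g w) w) = 0"
      unfolding K_def c_def \<pi>_def
      using kernel_element_matrix_coefficients[OF G act a ker[unfolded \<pi>_def]] by blast
    then show ?case
      using Cons by (simp add: distrib_left sum.distrib)
  qed simp
  then have "(\<Sum>g\<in>K. c g * s g) = 0"
    using \<nu>s by (simp add: s_def)
  moreover have "(\<Sum>g\<in>K. c g * (if g = \<one>\<^bsub>G\<^esub> then 1 else 0)) = c \<one>\<^bsub>G\<^esub>"
    using K by (simp add: if_distrib cong: if_cong)
  ultimately have "c \<one>\<^bsub>G\<^esub> = (\<Sum>g\<in>K. c g * ((if g = \<one>\<^bsub>G\<^esub> then 1 else 0) - s g))"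
    by (simp add: right_diff_distrib sum_subtractf)
  then have "cmod (c \<one>\<^bsub>G\<^esub>) \<le> (\<Sum>g\<in>K. cmod (c g) * cmod ((if g = \<one>\<^bsub>G\<^esub> then 1 else 0) - s g))"
    by (simp only: norm_sum flip: norm_mult)
  also have "\<dots> \<le> (\<Sum>g\<in>K. cmod (c g) * \<epsilon>)"
    using close reg by (intro sum_mono mult_left_mono) (fastforce simp: s_def)+
  also have "\<dots> = B * \<epsilon>"
    by (simp add: B_def sum_distrib_right)
  also have "\<dots> = cmod (c \<one>\<^bsub>G\<^esub>) / 2"
    using B by (simp add: \<epsilon>_def)
  finally show False
    using c1 by simp
qed

lemma bij_betw_map_nlists:
  assumes f: "bij_betw f V V"
  shows "bij_betw (map f) (nlists n V) (nlists n V)"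
proof (rule bij_betw_byWitness[where f' = "map (inv_into V f)"])
  have V: "x \<in> V" if "xs \<in> nlists n V" "x \<in> set xs" for x xs
    using nlistsE_set[OF that(1)] that(2) by (rule subsetD)
  show "\<forall>xs\<in>nlists n V. map (inv_into V f) (map f xs) = xs"
    unfolding map_map
    by (intro ballI map_idI) (simp add: V bij_betw_inv_into_left[OF f])
  show "\<forall>xs\<in>nlists n V. map f (map (inv_into V f) xs) = xs"
    unfolding map_map
    by (intro ballI map_idI) (simp add: V bij_betw_inv_into_right[OF f])
  show "map f ` nlists n V \<subseteq> nlists n V"
    by (intro image_subsetI nlistsI) (auto simp: V bij_betw_apply[OF f])
  show "map (inv_into V f) ` nlists n V \<subseteq> nlists n V"
    by (intro image_subsetI nlistsI) (auto simp: V bij_betw_apply[OF bij_betw_inv_into[OF f]])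
qed

section \<open>Tensor powers of the tree representation\<close>

theorem proposition6p9:
  fixes d :: nat and V :: "'v set" and E :: "'v \<Rightarrow> 'v \<Rightarrow> bool" and r :: 'v
    and G :: "('v \<Rightarrow> 'v) set" and GG :: "('v \<Rightarrow> 'v) monoid" and n :: nat
  assumes "regular_rooted_tree d V E r"
    and "weakly_branched V E r G"
    and "GG = (tree_Aut V E r)\<lparr>carrier := G\<rparr>"
    and "n > 0"
  shows "\<not> inj_on (algebra_rep (tree_rep_tensor GG V n)) (group_algebra GG)
       \<and> \<not> weakly_contains GG (tree_rep_tensor GG V n) (regular_rep GG)"
proof -
  interpret regular_rooted_tree d V E r by (rule assms(1))
  have sub: "subgroup G (tree_Aut V E r)"
    and rist: "\<And>v. v \<in> V \<Longrightarrow> rist V E r G v \<noteq> {\<one>\<^bsub>tree_Aut V E r\<^esub>}"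
    using assms(2) unfolding weakly_branched_def by blast+
  have "subgroup G ((BijGroup V)\<lparr>carrier := carrier (tree_Aut V E r)\<rparr>)"
    using sub by (simp add: tree_Aut_def)
  then have G: "subgroup G (BijGroup V)"
    by (rule group.incl_subgroup[OF group_BijGroup tree_Aut_subgroup_BijGroup])
  have GG: "GG = (BijGroup V)\<lparr>carrier := G\<rparr>"
    using assms(3) by (simp add: tree_Aut_def)
  have GA: "G \<subseteq> carrier (tree_Aut V E r)"
    using sub by (rule subgroup.subset)
  have one: "\<one>\<^bsub>tree_Aut V E r\<^esub> = \<one>\<^bsub>BijGroup V\<^esub>"
    by (simp add: tree_Aut_def)
  obtain I where I: "I \<subseteq> tree_level V E r n" "finite I" "card I = Suc n"
    using large_level by blast
  have IV: "v \<in> V" if "v \<in> I" for v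
    using I(1) that by (auto simp: tree_level_def)
  have "\<exists>g\<in>rist V E r G v. g \<noteq> \<one>\<^bsub>BijGroup V\<^esub>" if v: "v \<in> I" for v
  proof -
    have "\<one>\<^bsub>BijGroup V\<^esub> \<in> rist V E r G v"
      using subgroup.one_closed[OF G]
      by (auto simp: rist_def subtree_Stab_def BijGroup_def subtree_def)
    then show ?thesis
      using rist[OF IV[OF v]] one by auto
  qed
  then obtain \<gamma> where \<gamma>: "\<And>v. v \<in> I \<Longrightarrow> \<gamma> v \<in> rist V E r G v"
    "\<And>v. v \<in> I \<Longrightarrow> \<gamma> v \<noteq> \<one>\<^bsub>BijGroup V\<^esub>"
    by metis
  have \<gamma>G: "\<gamma> v \<in> G" if "v \<in> I" for v
    using \<gamma>(1)[OF that] by (simp add: rist_def)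
  have "disjoint_family_on (subtree V E r) I"
    using disjoint_family_on_mono[OF I(1) subtrees_of_level_disjoint] .
  then obtain a where a: "a \<in> group_algebra GG" "Poly_Mapping.lookup a \<one>\<^bsub>GG\<^esub> = 1"
    and ker: "algebra_rep (tree_rep_tensor GG V n) a = algebra_rep (tree_rep_tensor GG V n) 0"
  proof -
    have "\<exists>a \<in> group_algebra GG. Poly_Mapping.lookup a \<one>\<^bsub>GG\<^esub> = 1 \<and>
        algebra_rep (tree_rep_tensor GG V n) a = algebra_rep (tree_rep_tensor GG V n) 0"
      unfolding GG
    proof (rule exists_annihilator[OF G I(2)])
      show "n < card I"
        using I(3) by simp
      show "\<gamma> v x = x" if "v \<in> I" "x \<in> V" "x \<notin> subtree V E r v" for v x
        using rist_fixes_outside_subtree[OF GA IV[OF that(1)] \<gamma>(1)[OF that(1)] that(2,3)] .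
    qed (use \<gamma>G \<gamma>(2) \<open>disjoint_family_on (subtree V E r) I\<close> in blast)+
    then show ?thesis
      using that by blast
  qed
  have "a \<noteq> 0"
    using a(2) by auto
  moreover have "0 \<in> group_algebra GG"
    by (simp add: group_algebra_def)
  ultimately have "\<not> inj_on (algebra_rep (tree_rep_tensor GG V n)) (group_algebra GG)"
    using inj_onD[OF _ ker a(1)] by blast
  moreover have "\<not> weakly_contains GG (tree_rep_tensor GG V n) (regular_rep GG)"
    unfolding tree_rep_tensor_def
  proof (rule kernel_element_obstructs_weak_containment)
    show "group GG"
      unfolding GG using G group_BijGroup by (rule subgroup.subgroup_is_group)
    show "bij_betw (map g) (nlists n V) (nlists n V)" if "g \<in> carrier GG" for g
      using that subgroup.subset[OF G]
      by (intro bij_betw_map_nlists) (auto simp: GG BijGroup_def Bij_def)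
    show "algebra_rep (permutation_rep GG (nlists n V) map) a
        = algebra_rep (permutation_rep GG (nlists n V) map) 0"
      using ker by (simp only: tree_rep_tensor_def)
    show "Poly_Mapping.lookup a \<one>\<^bsub>GG\<^esub> \<noteq> 0"
      using a(2) by simp
  qed (rule a(1))
  ultimately show ?thesis
    by blast
qed

end
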